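(* For general points $u_1,u_2\in\mathbb{R}^2$ and general fundamental matrices $F\in\mathbb{R}^{3\times 3}$ (i.e. real $3\times 3$ matrices of rank two), the two-view triangulation problem $$\min_{x_1,x_2\in\mathbb{R}^2}\ \|x_1-u_1\|_2^2+\|x_2-u_2\|_2^2\quad\text{subject to}\quad \widehat{x}_2^{\top}F\,\widehat{x}_1=0,$$ where $\widehat{x}_k:=(x_k^\top\ 1)^\top$ for $k=1,2$, has exactly six distinct complex critical points $(x_1,x_2)\in\mathbb{C}^2\times\mathbb{C}^2$.
   Context: A fundamental matrix is a matrix $F\in\mathbb{R}^{3\times 3}$ of rank two. For a vector $x=(x^{(1)},x^{(2)})^\top$ write $\widehat{x}:=(x^{(1)},x^{(2)},1)^\top$. Complex critical points: given $u_1=(u_{11},u_{12})^\top$, $u_2=(u_{21},u_{22})^\top\in\mathbb{R}^2$ and $F$, regard the objective $g(x_1,x_2)=\sum_{k=1}^2\sum_{l=1}^2 (x_{kl}-u_{kl})^2$ and the constraint function $h(x_1,x_2)=\widehat{x}_2^{\top}F\,\widehat{x}_1$ as polynomials in the four variables $x_{11},x_{12},x_{21},x_{22}$, where $x_k=(x_{k1},x_{k2})^\top$ (no complex conjugation is used; $\top$ is the plain transpose). A complex critical point of the problem is a point $(x_1,x_2)\in\mathbb{C}^2\times\mathbb{C}^2$ with $h(x_1,x_2)=0$ for which there is a Lagrange multiplier $\lambda\in\mathbb{C}$ with $\nabla g(x_1,x_2)+\lambda\nabla h(x_1,x_2)=0$, the gradients being taken with respect to all four variables. "General" is meant in the sense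 of algebraic geometry: there is a polynomial $P$ with real coefficients in the entries of $u_1,u_2,F$ which does not vanish identically on the set $\mathbb{R}^2\times\mathbb{R}^2\times\{F\in\mathbb{R}^{3\times3}:\operatorname{rank}F=2\}$, such that the conclusion holds for every $(u_1,u_2,F)$ in this set with $P(u_1,u_2,F)\neq 0$. *)

theory Defs
  imports "HOL-Analysis.Analysis"
begin

definition fundamental_matrix :: "real^3^3 \<Rightarrow> bool" where
  "fundamental_matrix F \<longleftrightarrow> rank F = 2"

definition hat :: "'a::{zero,one}^2 \<Rightarrow> 'a^3" where
  "hat x = vector [x $ 1, x $ 2, 1]"

text \<open>The objective and the constraint have real data but are polynomials in the coordinates of
  the two points, to be evaluated over the reals (the optimization problem) or over the complex
  numbers (its critical points). The bilinear form is written out as a sum because the library's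
  inner product on complex vectors is the real one, which involves conjugation.\<close>

definition objective ::
    "real^2 \<Rightarrow> real^2 \<Rightarrow> 'a::real_normed_field^2 \<Rightarrow> 'a^2 \<Rightarrow> 'a" where
  "objective u1 u2 x1 x2 =
     (\<Sum>l\<in>UNIV. (x1 $ l - of_real (u1 $ l))\<^sup>2) + (\<Sum>l\<in>UNIV. (x2 $ l - of_real (u2 $ l))\<^sup>2)"

definition epipolar ::
    "real^3^3 \<Rightarrow> 'a::real_normed_field^2 \<Rightarrow> 'a^2 \<Rightarrow> 'a" where
  "epipolar F x1 x2 = (\<Sum>i\<in>UNIV. hat x2 $ i * (map_matrix of_real F *v hat x1) $ i)"

text \<open>The gradient in all four variables, split into its two blocks. For \<open>'a = complex\<close>
  the partial derivatives are the holomorphic ones, so on polynomials they agree with the formal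
  partial derivatives.\<close>

definition gradient1 ::
    "('a::real_normed_field^2 \<Rightarrow> 'a^2 \<Rightarrow> 'a) \<Rightarrow> 'a^2 \<Rightarrow> 'a^2 \<Rightarrow> 'a^2" where
  "gradient1 f x1 x2 = (\<chi> l. deriv (\<lambda>t. f (x1 + t *s axis l 1) x2) 0)"

definition gradient2 ::
    "('a::real_normed_field^2 \<Rightarrow> 'a^2 \<Rightarrow> 'a) \<Rightarrow> 'a^2 \<Rightarrow> 'a^2 \<Rightarrow> 'a^2" where
  "gradient2 f x1 x2 = (\<chi> l. deriv (\<lambda>t. f x1 (x2 + t *s axis l 1)) 0)"

definition complex_critical_points ::
    "real^2 \<Rightarrow> real^2 \<Rightarrow> real^3^3 \<Rightarrow> ((complex^2) \<times> (complex^2)) set" where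
  "complex_critical_points u1 u2 F =
     {(x1, x2). epipolar F x1 x2 = 0 \<and>
        (\<exists>\<mu>::complex.
           gradient1 (objective u1 u2) x1 x2 + \<mu> *s gradient1 (epipolar F) x1 x2 = 0 \<and>
           gradient2 (objective u1 u2) x1 x2 + \<mu> *s gradient2 (epipolar F) x1 x2 = 0)}"

end

theory Submission
  imports Defs "Subresultants.Subresultant_Gcd" "HOL-Computational_Algebra.Field_as_Ring"
    "HOL-Computational_Algebra.Fundamental_Theorem_Algebra"
begin

text \<open>
  Let \<open>A\<close> be the upper left \<open>2 \<times> 2\<close> block of \<open>F\<close>. If \<open>A\<close> is invertible then, since \<open>det F = 0\<close>, a
  translation of both points turns the constraint into \<open>z\<^sup>T A y = 0\<close>, and a critical point with
  multiplier \<open>2 \<nu>\<close> is a solution of \<open>y + \<nu> A\<^sup>T z = a\<close>, \<open>z + \<nu> A y = b\<close>, \<open>z\<^sup>T A y = 0\<close>.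
  By Cramer's rule \<open>D(\<nu>) y = Y(\<nu>)\<close> and \<open>D(\<nu>) z = Z(\<nu>)\<close> with \<open>D(\<nu>) = det (I - \<nu>\<^sup>2 A\<^sup>T A)\<close>
  of degree 4 and \<open>Y\<close>, \<open>Z\<close> of degree 3, so that \<open>\<nu>\<close> is a root of the sextic \<open>Q = Z\<^sup>T A Y\<close>. If
  \<open>Q D\<close> has degree 10 and no multiple root, then \<open>D\<close> does not vanish at the six simple roots of \<open>Q\<close>,
  each of which gives exactly one critical point. This condition is the nonvanishing
  of the leading coefficient and of the resultant of \<open>Q D\<close> with its derivative, which are polynomials
  in the data; one numerical instance shows that they do not vanish identically.
\<close>

no_notation Matrix.vec_index (infixl "$" 100)

section \<open>Polynomial dependence on the data\<close>

text \<open>Complex values are needed because the resultants are taken over the complex numbers,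
  while the final polynomial in the data must be real.\<close>

definition complex_polynomial_function :: "('a::real_normed_vector \<Rightarrow> complex) \<Rightarrow> bool" where
  "complex_polynomial_function f \<longleftrightarrow>
     real_polynomial_function (\<lambda>x. Re (f x)) \<and> real_polynomial_function (\<lambda>x. Im (f x))"

lemma complex_polynomial_function_const [simp, intro]:
  "complex_polynomial_function (\<lambda>x. c)"
  by (simp add: complex_polynomial_function_def real_polynomial_function.intros)

lemma complex_polynomial_function_of_real:
  assumes "real_polynomial_function f"
  shows "complex_polynomial_function (\<lambda>x. of_real (f x))"
  using assms
  by (simp add: complex_polynomial_function_def real_polynomial_function.intros)

lemma complex_polynomial_function_add [intro]:
  assumes "complex_polynomial_function f" "complex_polynomial_function g"
  shows "complex_polynomial_function (\<lambda>x. f x + g x)"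
  using assms by (auto simp: complex_polynomial_function_def)

lemma complex_polynomial_function_mult [intro]:
  assumes "complex_polynomial_function f" "complex_polynomial_function g"
  shows "complex_polynomial_function (\<lambda>x. f x * g x)"
  using assms
  by (auto simp: complex_polynomial_function_def)

lemma complex_polynomial_function_minus [intro]:
  assumes "complex_polynomial_function f"
  shows "complex_polynomial_function (\<lambda>x. - f x)"
  using complex_polynomial_function_mult[OF complex_polynomial_function_const[of "-1"] assms] by simp

lemma complex_polynomial_function_diff [intro]:
  assumes "complex_polynomial_function f" "complex_polynomial_function g"
  shows "complex_polynomial_function (\<lambda>x. f x - g x)"
  using complex_polynomial_function_add[OF assms(1) complex_polynomial_function_minus[OF assms(2)]]
  by simp

lemma complex_polynomial_function_power [intro]:
  assumes "complex_polynomial_function f"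
  shows "complex_polynomial_function (\<lambda>x. f x ^ n)"
  using assms by (induction n) auto

lemma complex_polynomial_function_sum [intro]:
  assumes "\<And>i. i \<in> I \<Longrightarrow> complex_polynomial_function (f i)"
  shows "complex_polynomial_function (\<lambda>x. \<Sum>i\<in>I. f i x)"
  using assms by (induction I rule: infinite_finite_induct) auto

lemma complex_polynomial_function_prod [intro]:
  assumes "\<And>i. i \<in> I \<Longrightarrow> complex_polynomial_function (f i)"
  shows "complex_polynomial_function (\<lambda>x. \<Prod>i\<in>I. f i x)"
  using assms by (induction I rule: infinite_finite_induct) auto

lemma complex_polynomial_function_If [intro]:
  assumes "complex_polynomial_function f" "complex_polynomial_function g"
  shows "complex_polynomial_function (\<lambda>x. if b then f x else g x)"
  using assms by (cases b) simp_all

definition polynomial_coefficients :: "('a::real_normed_vector \<Rightarrow> complex poly) \<Rightarrow> bool" where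
  "polynomial_coefficients f \<longleftrightarrow> (\<forall>i. complex_polynomial_function (\<lambda>x. coeff (f x) i))"

lemma polynomial_coefficients_0 [simp, intro]: "polynomial_coefficients (\<lambda>x. 0)"
  by (simp add: polynomial_coefficients_def)

lemma polynomial_coefficients_pCons [intro]:
  assumes "complex_polynomial_function f" "polynomial_coefficients g"
  shows "polynomial_coefficients (\<lambda>x. pCons (f x) (g x))"
  unfolding polynomial_coefficients_def
proof
  show "complex_polynomial_function (\<lambda>x. coeff (pCons (f x) (g x)) i)" for i
    using assms by (cases i) (auto simp: polynomial_coefficients_def)
qed

lemma polynomial_coefficients_add [intro]:
  assumes "polynomial_coefficients f" "polynomial_coefficients g"
  shows "polynomial_coefficients (\<lambda>x. f x + g x)"
  using assms by (auto simp: polynomial_coefficients_def)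

lemma polynomial_coefficients_mult [intro]:
  assumes "polynomial_coefficients f" "polynomial_coefficients g"
  shows "polynomial_coefficients (\<lambda>x. f x * g x)"
  using assms unfolding polynomial_coefficients_def coeff_mult
  by (intro allI complex_polynomial_function_sum complex_polynomial_function_mult) auto

lemma polynomial_coefficients_pderiv [intro]:
  assumes "polynomial_coefficients f"
  shows "polynomial_coefficients (\<lambda>x. pderiv (f x))"
  using assms by (auto simp: polynomial_coefficients_def coeff_pderiv)

text \<open>The size \<open>m + n\<close> of the Sylvester matrix is fixed and does not follow the
  degrees of \<open>f x\<close> and \<open>g x\<close>, which may drop for special \<open>x\<close>.
  The Leibniz formula is therefore one polynomial expression in the coefficients for all
  \<open>x\<close>.\<close>

lemma complex_polynomial_function_resultant_sub [intro]:
  assumes "polynomial_coefficients f" "polynomial_coefficients g"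
  shows "complex_polynomial_function (\<lambda>x. resultant_sub m n (f x) (g x))"
proof -
  have entry: "complex_polynomial_function (\<lambda>x. sylvester_mat_sub m n (f x) (g x) $$ (i, j))"
    if "i < m + n" "j < m + n" for i j
    using assms that
    unfolding polynomial_coefficients_def
    \<comment> \<open>The case distinctions in an entry depend only on the indices and on
      \<open>m\<close>, \<open>n\<close>, never on \<open>x\<close>.\<close>
    by (simp only: sylvester_mat_sub_index)
      (intro complex_polynomial_function_If complex_polynomial_function_const, auto)
  have "resultant_sub m n (f x) (g x) =
      (\<Sum>\<pi> \<in> {\<pi>. \<pi> permutes {0..<m+n}}.
        signof \<pi> * (\<Prod>i = 0..<m+n. sylvester_mat_sub m n (f x) (g x) $$ (i, \<pi> i)))" for x
    unfolding resultant_sub_def by (rule det_def'[OF sylvester_mat_sub_carrier])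
  moreover have "\<pi> i < m + n" if "\<pi> permutes {0..<m+n}" "i < m + n" for \<pi> i
    using that permutes_in_image[of \<pi> "{0..<m+n}" i] by auto
  ultimately show ?thesis
    by (auto intro!: complex_polynomial_function_sum complex_polynomial_function_mult
        complex_polynomial_function_prod entry)
qed

section \<open>Resultants and simple roots\<close>

lemma resultant_nonzero_iff_coprime:
  fixes f g :: "complex poly"
  assumes "f \<noteq> 0"
  shows "resultant f g \<noteq> 0 \<longleftrightarrow> coprime f g"
proof -
  have "gcd f g \<noteq> 0" using assms by simp
  then have "degree (gcd f g) = 0 \<longleftrightarrow> is_unit (gcd f g)"
    by (rule is_unit_iff_degree[symmetric])
  then show ?thesis
    by (simp only: resultant_0_gcd is_unit_gcd not_not)
qed

lemma card_roots_rsquarefree: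
  fixes f :: "complex poly"
  assumes "rsquarefree f"
  shows "card {z. poly f z = 0} = degree f"
proof -
  have f: "f \<noteq> 0" using assms by (simp add: rsquarefree_def)
  have "degree f = degree (\<Prod>z | poly f z = 0. [:-z, 1:])"
    using complex_poly_decompose_rsquarefree[OF assms] f
    by (metis degree_smult_eq leading_coeff_0_iff)
  also have "\<dots> = (\<Sum>z | poly f z = 0. degree [:-z, 1:])"
    by (rule degree_prod_sum_eq) auto
  finally show ?thesis by simp
qed

text \<open>By the product rule, a multiple root of \<open>f\<close> or a common root of
  \<open>f\<close> and \<open>g\<close> is a common root of \<open>f * g\<close> and its derivative.
  The degree assumption makes the fixed-size resultant the ordinary one, so its nonvanishing
  excludes such roots.\<close>

lemma simple_roots_of_resultant:
  fixes f g :: "complex poly"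
  assumes deg: "degree (f * g) = Suc n"
    and res: "resultant_sub (Suc n) n (f * g) (pderiv (f * g)) \<noteq> 0"
  shows "card {z. poly f z = 0} = degree f"
    and "poly f z = 0 \<Longrightarrow> poly g z \<noteq> 0"
proof -
  have fg: "f * g \<noteq> 0" using deg by auto
  have "degree (pderiv (f * g)) = n" using deg by (simp add: degree_pderiv)
  then have "resultant (f * g) (pderiv (f * g)) \<noteq> 0"
    using deg res by (simp add: resultant_sub)
  then have cop: "coprime (f * g) (pderiv (f * g))"
    using resultant_nonzero_iff_coprime[OF fg] by blast
  have no_common: "\<not> (poly (f * g) z = 0 \<and> poly (pderiv (f * g)) z = 0)" for z
  proof
    assume "poly (f * g) z = 0 \<and> poly (pderiv (f * g)) z = 0"
    then have "[:-z, 1:] dvd f * g" "[:-z, 1:] dvd pderiv (f * g)"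
      by (simp_all only: poly_eq_0_iff_dvd)
    then have "is_unit [:-z, 1:]" by (rule coprime_common_divisor[OF cop])
    then show False by (simp add: is_unit_iff_degree)
  qed
  have "rsquarefree f"
    unfolding rsquarefree_roots
  proof (intro allI notI)
    show False if "poly f z = 0 \<and> poly (pderiv f) z = 0" for z
      using no_common[of z] that by (simp add: pderiv_mult)
  qed
  then show "card {z. poly f z = 0} = degree f" by (rule card_roots_rsquarefree)
  show "poly g z \<noteq> 0" if "poly f z = 0"
    using no_common[of z] that by (auto simp: pderiv_mult)
qed

section \<open>Critical points of a bilinear constraint\<close>

text \<open>The matrix of the bilinear form is \<open>A = (p q; r s)\<close>; \<open>a\<close>, \<open>b\<close> are the data points and
  \<open>\<nu>\<close> is half the Lagrange multiplier.\<close>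

locale bilinear_problem =
  fixes p q r s a1 a2 b1 b2 :: complex
begin

definition bilinear :: "complex \<Rightarrow> complex \<Rightarrow> complex \<Rightarrow> complex \<Rightarrow> complex" where
  "bilinear y1 y2 z1 z2 = z1 * (p * y1 + q * y2) + z2 * (r * y1 + s * y2)"

definition stationary :: "complex \<Rightarrow> complex \<Rightarrow> complex \<Rightarrow> complex \<Rightarrow> complex \<Rightarrow> bool" where
  "stationary \<nu> y1 y2 z1 z2 \<longleftrightarrow>
     y1 + \<nu> * (p * z1 + r * z2) = a1 \<and> y2 + \<nu> * (q * z1 + s * z2) = a2 \<and>
     z1 + \<nu> * (p * y1 + q * y2) = b1 \<and> z2 + \<nu> * (r * y1 + s * y2) = b2"

text \<open>Here \<open>D(\<nu>) = det (I - \<nu>\<^sup>2 A\<^sup>T A)\<close>, and \<open>(Y1, Y2) = adj (I - \<nu>\<^sup>2 A\<^sup>T A) (a - \<nu> A\<^sup>T b)\<close>,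
  \<open>(Z1, Z2) = adj (I - \<nu>\<^sup>2 A A\<^sup>T) (b - \<nu> A a)\<close> are the numerators in Cramer's rule.\<close>

definition D :: "complex poly" where
  "D = [:1, 0, - (p\<^sup>2 + q\<^sup>2 + r\<^sup>2 + s\<^sup>2), 0, (p * s - q * r)\<^sup>2:]"

definition Y1 :: "complex poly" where
  "Y1 = [:1, 0, - (q\<^sup>2 + s\<^sup>2):] * [:a1, - (p * b1 + r * b2):]
      + [:0, 0, p * q + r * s:] * [:a2, - (q * b1 + s * b2):]"

definition Y2 :: "complex poly" where
  "Y2 = [:0, 0, p * q + r * s:] * [:a1, - (p * b1 + r * b2):]
      + [:1, 0, - (p\<^sup>2 + r\<^sup>2):] * [:a2, - (q * b1 + s * b2):]"

definition Z1 :: "complex poly" where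
  "Z1 = [:1, 0, - (r\<^sup>2 + s\<^sup>2):] * [:b1, - (p * a1 + q * a2):]
      + [:0, 0, p * r + q * s:] * [:b2, - (r * a1 + s * a2):]"

definition Z2 :: "complex poly" where
  "Z2 = [:0, 0, p * r + q * s:] * [:b1, - (p * a1 + q * a2):]
      + [:1, 0, - (p\<^sup>2 + q\<^sup>2):] * [:b2, - (r * a1 + s * a2):]"

definition Q :: "complex poly" where
  "Q = Z1 * ([:p:] * Y1 + [:q:] * Y2) + Z2 * ([:r:] * Y1 + [:s:] * Y2)"

lemma poly_Q: "poly Q \<nu> = bilinear (poly Y1 \<nu>) (poly Y2 \<nu>) (poly Z1 \<nu>) (poly Z2 \<nu>)"
  by (simp add: Q_def bilinear_def)

lemma degree_D: "degree D \<le> 4"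
  by (simp add: D_def)

text \<open>Together with \<open>degree_D\<close> this bounds the degree of \<open>Q * D\<close> by
  10, so that coefficient 10 decides whether both bounds are attained.\<close>

lemma degree_Q: "degree Q \<le> 6"
proof -
  have quad_lin: "degree ([:c0, c1, c2:] * [:d0, d1:]) \<le> 3" for c0 c1 c2 d0 d1 :: complex
    using degree_mult_le[of "[:c0, c1, c2:]" "[:d0, d1:]"]
    by (auto split: if_splits intro: le_trans)
  have cub: "degree Y1 \<le> 3" "degree Y2 \<le> 3" "degree Z1 \<le> 3" "degree Z2 \<le> 3"
    unfolding Y1_def Y2_def Z1_def Z2_def by (intro degree_add_le quad_lin)+
  have const: "degree ([:c:] * f) \<le> 3" if "degree f \<le> 3" for c :: complex and f
    using degree_mult_le[of "[:c:]" f] that by simp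
  have cubcub: "degree (f * g) \<le> 6" if "degree f \<le> 3" "degree g \<le> 3" for f g :: "complex poly"
    using degree_mult_le[of f g] that by linarith
  show ?thesis
    unfolding Q_def by (intro degree_add_le cubcub const cub)
qed

text \<open>Substituting the stationarity equations for the data leaves polynomial identities. They
  hold also at roots of \<open>D\<close>, which later rules out critical points with such a
  multiplier.\<close>

lemma stationary_imp:
  assumes "stationary \<nu> y1 y2 z1 z2"
  shows "poly D \<nu> * y1 = poly Y1 \<nu>" "poly D \<nu> * y2 = poly Y2 \<nu>"
    "poly D \<nu> * z1 = poly Z1 \<nu>" "poly D \<nu> * z2 = poly Z2 \<nu>"
proof -
  have eqs: "a1 = y1 + \<nu> * (p * z1 + r * z2)" "a2 = y2 + \<nu> * (q * z1 + s * z2)"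
    "b1 = z1 + \<nu> * (p * y1 + q * y2)" "b2 = z2 + \<nu> * (r * y1 + s * y2)"
    using assms by (auto simp: stationary_def)
  show "poly D \<nu> * y1 = poly Y1 \<nu>" "poly D \<nu> * y2 = poly Y2 \<nu>"
    "poly D \<nu> * z1 = poly Z1 \<nu>" "poly D \<nu> * z2 = poly Z2 \<nu>"
    unfolding D_def Y1_def Y2_def Z1_def Z2_def
    by (simp_all add: eqs algebra_simps power2_eq_square)
qed

lemma stationary_cramer:
  assumes "poly D \<nu> \<noteq> 0"
  shows "stationary \<nu> (poly Y1 \<nu> / poly D \<nu>) (poly Y2 \<nu> / poly D \<nu>)
           (poly Z1 \<nu> / poly D \<nu>) (poly Z2 \<nu> / poly D \<nu>)"
proof -
  have "poly Y1 \<nu> + \<nu> * (p * poly Z1 \<nu> + r * poly Z2 \<nu>) = poly D \<nu> * a1"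
       "poly Y2 \<nu> + \<nu> * (q * poly Z1 \<nu> + s * poly Z2 \<nu>) = poly D \<nu> * a2"
       "poly Z1 \<nu> + \<nu> * (p * poly Y1 \<nu> + q * poly Y2 \<nu>) = poly D \<nu> * b1"
       "poly Z2 \<nu> + \<nu> * (r * poly Y1 \<nu> + s * poly Y2 \<nu>) = poly D \<nu> * b2"
    by (simp_all add: D_def Y1_def Y2_def Z1_def Z2_def algebra_simps power2_eq_square)
  then show ?thesis
    using assms by (simp add: stationary_def field_simps)
qed

text \<open>Two multipliers for one point force \<open>A y = 0\<close> and
  \<open>A\<^sup>T z = 0\<close>. Then \<open>y\<close> and \<open>z\<close> vanish, hence so do the
  data, and \<open>Q\<close> would be zero.\<close>

lemma stationary_multiplier_unique:
  assumes det: "p * s - q * r \<noteq> 0" and Q: "Q \<noteq> 0"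
    and st: "stationary \<nu> y1 y2 z1 z2" "stationary \<nu>' y1 y2 z1 z2"
  shows "\<nu> = \<nu>'"
proof (rule ccontr)
  assume ne: "\<nu> \<noteq> \<nu>'"
  have "\<nu> * (p * z1 + r * z2) = \<nu>' * (p * z1 + r * z2)"
    "\<nu> * (q * z1 + s * z2) = \<nu>' * (q * z1 + s * z2)"
    "\<nu> * (p * y1 + q * y2) = \<nu>' * (p * y1 + q * y2)"
    "\<nu> * (r * y1 + s * y2) = \<nu>' * (r * y1 + s * y2)"
    using st unfolding stationary_def by (metis add_left_cancel)+
  then have zero: "p * z1 + r * z2 = 0" "q * z1 + s * z2 = 0"
    "p * y1 + q * y2 = 0" "r * y1 + s * y2 = 0"
    using ne by simp_all
  have "(p * s - q * r) * z1 = s * (p * z1 + r * z2) - r * (q * z1 + s * z2)"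
    "(p * s - q * r) * z2 = p * (q * z1 + s * z2) - q * (p * z1 + r * z2)"
    "(p * s - q * r) * y1 = s * (p * y1 + q * y2) - q * (r * y1 + s * y2)"
    "(p * s - q * r) * y2 = p * (r * y1 + s * y2) - r * (p * y1 + q * y2)"
    by (simp_all add: algebra_simps)
  then have "y1 = 0" "y2 = 0" "z1 = 0" "z2 = 0" using det unfolding zero by simp_all
  then have "a1 = 0" "a2 = 0" "b1 = 0" "b2 = 0"
    using st(1) by (simp_all add: stationary_def)
  then have "Q = 0" unfolding Q_def Y1_def Y2_def by simp
  with Q show False by simp
qed

text \<open>Cramer's rule gives a bijection from the roots of \<open>Q\<close> to the critical
  points.\<close>

lemma card_critical:
  assumes det: "p * s - q * r \<noteq> 0"
    and lc: "coeff (Q * D) 10 \<noteq> 0"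
    and res: "resultant_sub 10 9 (Q * D) (pderiv (Q * D)) \<noteq> 0"
  shows "card {(y1, y2, z1, z2). bilinear y1 y2 z1 z2 = 0 \<and> (\<exists>\<nu>. stationary \<nu> y1 y2 z1 z2)} = 6"
proof -
  \<comment> \<open>Squeezing 10 between the degree of \<open>Q * D\<close> and \<open>6 + 4\<close>
    forces \<open>Q\<close> to have degree exactly 6.\<close>
  have deg_le: "degree (Q * D) \<le> degree Q + degree D" by (rule degree_mult_le)
  moreover have "10 \<le> degree (Q * D)" using lc by (rule le_degree)
  ultimately have deg: "degree (Q * D) = Suc 9" "degree Q = 6"
    using degree_Q degree_D by linarith+
  have card_roots: "card {\<nu>. poly Q \<nu> = 0} = 6"
    using simple_roots_of_resultant(1)[OF deg(1)] res deg(2) by simp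
  have D: "poly D \<nu> \<noteq> 0" if "poly Q \<nu> = 0" for \<nu>
    using simple_roots_of_resultant(2)[OF deg(1)] res that by simp
  define pt where "pt = (\<lambda>\<nu>. (poly Y1 \<nu> / poly D \<nu>, poly Y2 \<nu> / poly D \<nu>,
    poly Z1 \<nu> / poly D \<nu>, poly Z2 \<nu> / poly D \<nu>))"
  have "inj_on pt {\<nu>. poly Q \<nu> = 0}"
  proof (rule inj_onI)
    fix \<nu> \<nu>' assume "\<nu> \<in> {\<nu>. poly Q \<nu> = 0}" "\<nu>' \<in> {\<nu>. poly Q \<nu> = 0}" and eq: "pt \<nu> = pt \<nu>'"
    then have "stationary \<nu> (poly Y1 \<nu> / poly D \<nu>) (poly Y2 \<nu> / poly D \<nu>)
           (poly Z1 \<nu> / poly D \<nu>) (poly Z2 \<nu> / poly D \<nu>)"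
      and "stationary \<nu>' (poly Y1 \<nu>' / poly D \<nu>') (poly Y2 \<nu>' / poly D \<nu>')
           (poly Z1 \<nu>' / poly D \<nu>') (poly Z2 \<nu>' / poly D \<nu>')"
      using D by (auto intro: stationary_cramer)
    moreover have "Q \<noteq> 0" using deg(2) by auto
    ultimately show "\<nu> = \<nu>'"
      using eq det by (auto simp: pt_def intro: stationary_multiplier_unique)
  qed
  moreover have "pt ` {\<nu>. poly Q \<nu> = 0} =
    {(y1, y2, z1, z2). bilinear y1 y2 z1 z2 = 0 \<and> (\<exists>\<nu>. stationary \<nu> y1 y2 z1 z2)}"
    (is "_ = ?C")
  proof (intro equalityI subsetI)
    fix x assume "x \<in> pt ` {\<nu>. poly Q \<nu> = 0}"
    then obtain \<nu> where x: "x = pt \<nu>" and root: "poly Q \<nu> = 0" by auto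
    have "bilinear (poly Y1 \<nu> / poly D \<nu>) (poly Y2 \<nu> / poly D \<nu>)
           (poly Z1 \<nu> / poly D \<nu>) (poly Z2 \<nu> / poly D \<nu>) = poly Q \<nu> / (poly D \<nu>)\<^sup>2"
      by (simp add: poly_Q bilinear_def power2_eq_square add_divide_distrib distrib_left)
    then show "x \<in> ?C"
      using root stationary_cramer[OF D[OF root]] by (auto simp: x pt_def)
  next
    fix x assume "x \<in> ?C"
    then obtain y1 y2 z1 z2 \<nu> where x: "x = (y1, y2, z1, z2)"
      and bil: "bilinear y1 y2 z1 z2 = 0" and st: "stationary \<nu> y1 y2 z1 z2" by auto
    \<comment> \<open>The form is bilinear, so scaling both points by \<open>D\<close> gives the
      square. Thus \<open>\<nu>\<close> is a root of \<open>Q\<close> before anything is known about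
      \<open>D\<close>, and only then does \<open>D\<close> turn out to be nonzero at
      \<open>\<nu>\<close>.\<close>
    have "poly Q \<nu> = (poly D \<nu>)\<^sup>2 * bilinear y1 y2 z1 z2"
      unfolding poly_Q stationary_imp[OF st, symmetric] bilinear_def
      by (simp add: algebra_simps power2_eq_square)
    then have root: "poly Q \<nu> = 0" using bil by simp
    then have "x = pt \<nu>"
      using D[OF root] unfolding x pt_def stationary_imp[OF st, symmetric] by simp
    then show "x \<in> pt ` {\<nu>. poly Q \<nu> = 0}" using root by blast
  qed
  ultimately show ?thesis
    using card_image card_roots by metis
qed

end

lemma polynomial_coefficients_Q:
  assumes "complex_polynomial_function p" "complex_polynomial_function q"
    "complex_polynomial_function r" "complex_polynomial_function s"
    "complex_polynomial_function a1" "complex_polynomial_function a2"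
    "complex_polynomial_function b1" "complex_polynomial_function b2"
  shows "polynomial_coefficients
    (\<lambda>x. bilinear_problem.Q (p x) (q x) (r x) (s x) (a1 x) (a2 x) (b1 x) (b2 x))"
  unfolding bilinear_problem.Q_def bilinear_problem.Y1_def bilinear_problem.Y2_def
    bilinear_problem.Z1_def bilinear_problem.Z2_def
  by (intro polynomial_coefficients_add polynomial_coefficients_mult polynomial_coefficients_pCons
      polynomial_coefficients_0 complex_polynomial_function_minus complex_polynomial_function_add
      complex_polynomial_function_mult complex_polynomial_function_power
      complex_polynomial_function_const assms)

lemma polynomial_coefficients_D:
  assumes "complex_polynomial_function p" "complex_polynomial_function q"
    "complex_polynomial_function r" "complex_polynomial_function s"
  shows "polynomial_coefficients (\<lambda>x. bilinear_problem.D (p x) (q x) (r x) (s x))"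
  unfolding bilinear_problem.D_def
  by (intro polynomial_coefficients_pCons
      polynomial_coefficients_0 complex_polynomial_function_minus complex_polynomial_function_add
      complex_polynomial_function_diff
      complex_polynomial_function_mult complex_polynomial_function_power
      complex_polynomial_function_const assms)

section \<open>Reduction of the triangulation problem\<close>

lemma objective_gradient:
  fixes x1 x2 :: "complex^2"
  shows "gradient1 (objective u1 u2) x1 x2 $ l = 2 * (x1 $ l - of_real (u1 $ l))"
    and "gradient2 (objective u1 u2) x1 x2 $ l = 2 * (x2 $ l - of_real (u2 $ l))"
proof -
  have l: "l = 1 \<or> l = 2" by (rule exhaust_2)
  show "gradient1 (objective u1 u2) x1 x2 $ l = 2 * (x1 $ l - of_real (u1 $ l))"
    using l by (auto simp: gradient1_def objective_def sum_2 axis_def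
        intro!: DERIV_imp_deriv derivative_eq_intros)
  show "gradient2 (objective u1 u2) x1 x2 $ l = 2 * (x2 $ l - of_real (u2 $ l))"
    using l by (auto simp: gradient2_def objective_def sum_2 axis_def
        intro!: DERIV_imp_deriv derivative_eq_intros)
qed

lemma epipolar_expand:
  fixes x1 x2 :: "complex^2"
  shows "epipolar F x1 x2 =
     x2 $ 1 * (F $ 1 $ 1 * x1 $ 1 + F $ 1 $ 2 * x1 $ 2 + F $ 1 $ 3)
   + x2 $ 2 * (F $ 2 $ 1 * x1 $ 1 + F $ 2 $ 2 * x1 $ 2 + F $ 2 $ 3)
   + (F $ 3 $ 1 * x1 $ 1 + F $ 3 $ 2 * x1 $ 2 + F $ 3 $ 3)"
  by (simp add: epipolar_def sum_3 hat_def matrix_vector_mult_def map_matrix_def)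

lemma epipolar_gradient:
  fixes x1 x2 :: "complex^2"
  shows "gradient1 (epipolar F) x1 x2 $ 1 = F $ 1 $ 1 * x2 $ 1 + F $ 2 $ 1 * x2 $ 2 + F $ 3 $ 1"
    and "gradient1 (epipolar F) x1 x2 $ 2 = F $ 1 $ 2 * x2 $ 1 + F $ 2 $ 2 * x2 $ 2 + F $ 3 $ 2"
    and "gradient2 (epipolar F) x1 x2 $ 1 = F $ 1 $ 1 * x1 $ 1 + F $ 1 $ 2 * x1 $ 2 + F $ 1 $ 3"
    and "gradient2 (epipolar F) x1 x2 $ 2 = F $ 2 $ 1 * x1 $ 1 + F $ 2 $ 2 * x1 $ 2 + F $ 2 $ 3"
  unfolding gradient1_def gradient2_def epipolar_expand
  by (auto simp: axis_def intro!: DERIV_imp_deriv derivative_eq_intros)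

definition minor2 :: "real^3^3 \<Rightarrow> real" where
  "minor2 F = F $ 1 $ 1 * F $ 2 $ 2 - F $ 1 $ 2 * F $ 2 $ 1"

text \<open>This is \<open>x \<mapsto> det A x + adj(A) e\<close> for the first point, with \<open>e\<close> the top of the last column of \<open>F\<close>; the
  analogue with \<open>A\<^sup>T\<close> and the last row for the second. Scaling the translations by \<open>det A\<close> keeps
  everything polynomial in \<open>F\<close>.\<close>

definition centered ::
    "real^3^3 \<Rightarrow> (complex^2) \<times> (complex^2) \<Rightarrow> complex \<times> complex \<times> complex \<times> complex" where
  "centered F = (\<lambda>(x1, x2).
     (minor2 F * x1 $ 1 + (F $ 2 $ 2 * F $ 1 $ 3 - F $ 1 $ 2 * F $ 2 $ 3),
      minor2 F * x1 $ 2 + (F $ 1 $ 1 * F $ 2 $ 3 - F $ 2 $ 1 * F $ 1 $ 3),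
      minor2 F * x2 $ 1 + (F $ 2 $ 2 * F $ 3 $ 1 - F $ 2 $ 1 * F $ 3 $ 2),
      minor2 F * x2 $ 2 + (F $ 1 $ 1 * F $ 3 $ 2 - F $ 1 $ 2 * F $ 3 $ 1)))"

lemma bij_centered:
  assumes "minor2 F \<noteq> 0"
  shows "bij (centered F)"
proof (rule bijI)
  show "inj (centered F)"
    using assms by (auto simp: inj_def centered_def Finite_Cartesian_Product.vec_eq_iff forall_2)
  show "surj (centered F)"
    unfolding surj_def
  proof
    fix y :: "complex \<times> complex \<times> complex \<times> complex"
    obtain y1 y2 z1 z2 where y: "y = (y1, y2, z1, z2)" by (metis prod_cases4)
    have "y = centered F
      (vector [(y1 - (F $ 2 $ 2 * F $ 1 $ 3 - F $ 1 $ 2 * F $ 2 $ 3)) / minor2 F,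
               (y2 - (F $ 1 $ 1 * F $ 2 $ 3 - F $ 2 $ 1 * F $ 1 $ 3)) / minor2 F],
       vector [(z1 - (F $ 2 $ 2 * F $ 3 $ 1 - F $ 2 $ 1 * F $ 3 $ 2)) / minor2 F,
               (z2 - (F $ 1 $ 1 * F $ 3 $ 2 - F $ 1 $ 2 * F $ 3 $ 1)) / minor2 F])"
      using assms by (simp add: centered_def y)
    then show "\<exists>x. y = centered F x" by (rule exI)
  qed
qed

definition complexify :: "real^'n \<Rightarrow> complex^'n" where
  "complexify x = (\<chi> i. of_real (x $ i))"

text \<open>Centering absorbs the linear terms of the constraint, and \<open>det F = 0\<close> makes
  the remaining constant vanish. Data and variables are moved by the same map, so the Lagrange
  equations change only by the factor \<open>\<delta> / 2\<close>.\<close>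

lemma critical_point_iff:
  assumes minor: "minor2 F \<noteq> 0" and det: "Determinants.det F = 0"
    and a: "centered F (complexify u1, complexify u2) = (a1, a2, b1, b2)"
    and y: "centered F x = (y1, y2, z1, z2)"
  shows "x \<in> complex_critical_points u1 u2 F \<longleftrightarrow>
    bilinear_problem.bilinear (F $ 1 $ 1) (F $ 1 $ 2) (F $ 2 $ 1) (F $ 2 $ 2) y1 y2 z1 z2 = 0 \<and>
    (\<exists>\<nu>. bilinear_problem.stationary (F $ 1 $ 1) (F $ 1 $ 2) (F $ 2 $ 1) (F $ 2 $ 2) a1 a2 b1 b2
      \<nu> y1 y2 z1 z2)"
proof -
  obtain x1 x2 where x: "x = (x1, x2)" by (cases x)
  define p q e r s f g h k where entries:
    "p = complex_of_real (F $ 1 $ 1)" "q = complex_of_real (F $ 1 $ 2)"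
    "e = complex_of_real (F $ 1 $ 3)" "r = complex_of_real (F $ 2 $ 1)"
    "s = complex_of_real (F $ 2 $ 2)" "f = complex_of_real (F $ 2 $ 3)"
    "g = complex_of_real (F $ 3 $ 1)" "h = complex_of_real (F $ 3 $ 2)"
    "k = complex_of_real (F $ 3 $ 3)"
  define \<delta> where "\<delta> = p * s - q * r"
  have minor_eq: "complex_of_real (minor2 F) = \<delta>"
    by (simp add: minor2_def \<delta>_def entries)
  have \<delta>: "\<delta> \<noteq> 0" using minor by (simp flip: minor_eq)
  have "complex_of_real (Determinants.det F) = 0" using det by simp
  \<comment> \<open>This expresses the entry \<open>k\<close> through the others; the left side is
    exactly the constant left over when the centered form is expanded.\<close>
  then have det0: "p * f * h + s * e * g - q * f * g - r * e * h = \<delta> * k"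
    by (simp add: det_3 \<delta>_def entries algebra_simps)
  have y_eq: "y1 = \<delta> * x1 $ 1 + (s * e - q * f)" "y2 = \<delta> * x1 $ 2 + (p * f - r * e)"
    "z1 = \<delta> * x2 $ 1 + (s * g - r * h)" "z2 = \<delta> * x2 $ 2 + (p * h - q * g)"
    using y by (auto simp: x centered_def minor_eq entries)
  have a_eq: "a1 = \<delta> * u1 $ 1 + (s * e - q * f)" "a2 = \<delta> * u1 $ 2 + (p * f - r * e)"
    "b1 = \<delta> * u2 $ 1 + (s * g - r * h)" "b2 = \<delta> * u2 $ 2 + (p * h - q * g)"
    using a by (auto simp: centered_def complexify_def minor_eq entries)
  have A: "p * y1 + q * y2 = \<delta> * (p * x1 $ 1 + q * x1 $ 2 + e)"
    "r * y1 + s * y2 = \<delta> * (r * x1 $ 1 + s * x1 $ 2 + f)"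
    "p * z1 + r * z2 = \<delta> * (p * x2 $ 1 + r * x2 $ 2 + g)"
    "q * z1 + s * z2 = \<delta> * (q * x2 $ 1 + s * x2 $ 2 + h)"
    by (simp_all add: y_eq \<delta>_def algebra_simps)
  have "z1 * (p * y1 + q * y2) + z2 * (r * y1 + s * y2) = \<delta> * (
      \<delta> * (x2 $ 1 * (p * x1 $ 1 + q * x1 $ 2 + e) + x2 $ 2 * (r * x1 $ 1 + s * x1 $ 2 + f)
         + (g * x1 $ 1 + h * x1 $ 2))
      + (p * f * h + s * e * g - q * f * g - r * e * h))"
    unfolding A by (simp add: y_eq \<delta>_def algebra_simps)
  also have "\<dots> = \<delta>\<^sup>2 * epipolar F x1 x2"
    unfolding det0 by (simp add: epipolar_expand power2_eq_square algebra_simps flip: entries)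
  finally have bil: "bilinear_problem.bilinear p q r s y1 y2 z1 z2 = 0 \<longleftrightarrow> epipolar F x1 x2 = 0"
    using \<delta> by (simp add: bilinear_problem.bilinear_def)
  \<comment> \<open>The factor 2 from differentiating the squares is why \<open>\<nu>\<close>
    corresponds to the multiplier \<open>2 * \<nu>\<close>.\<close>
  have scale: "\<delta> * t + c + \<nu> * (\<delta> * w) = \<delta> * u + c \<longleftrightarrow> 2 * (t - u) + (2 * \<nu>) * w = 0"
    for t c \<nu> w u
  proof -
    have "\<delta> * t + c + \<nu> * (\<delta> * w) - (\<delta> * u + c) = \<delta> / 2 * (2 * (t - u) + (2 * \<nu>) * w)"
      by (simp add: field_simps)
    then show ?thesis
      using \<delta> by (metis eq_iff_diff_eq_0 mult_eq_0_iff divide_eq_0_iff zero_neq_numeral)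
  qed
  define lagrange where "lagrange \<mu> \<longleftrightarrow>
    gradient1 (objective u1 u2) x1 x2 + \<mu> *s gradient1 (epipolar F) x1 x2 = 0 \<and>
    gradient2 (objective u1 u2) x1 x2 + \<mu> *s gradient2 (epipolar F) x1 x2 = 0" for \<mu>
  have "bilinear_problem.stationary p q r s a1 a2 b1 b2 \<nu> y1 y2 z1 z2 \<longleftrightarrow> lagrange (2 * \<nu>)" for \<nu>
    unfolding bilinear_problem.stationary_def A lagrange_def
    unfolding y_eq a_eq scale
    by (auto simp: Finite_Cartesian_Product.vec_eq_iff forall_2 objective_gradient
        epipolar_gradient simp flip: entries)
  moreover have "(\<exists>\<mu>. lagrange \<mu>) \<longleftrightarrow> (\<exists>\<nu>. lagrange (2 * \<nu>))"
    by (metis nonzero_mult_div_cancel_left times_divide_eq_right zero_neq_numeral)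
  moreover have "x \<in> complex_critical_points u1 u2 F \<longleftrightarrow>
      epipolar F x1 x2 = 0 \<and> (\<exists>\<mu>. lagrange \<mu>)"
    by (simp add: complex_critical_points_def x lagrange_def)
  ultimately show ?thesis
    using bil by (simp flip: entries)
qed

section \<open>The genericity polynomial and its nonvanishing\<close>

definition pencil_det :: "real^3^3 \<Rightarrow> complex poly" where
  "pencil_det F = bilinear_problem.D (F $ 1 $ 1) (F $ 1 $ 2) (F $ 2 $ 1) (F $ 2 $ 2)"

definition multiplier_sextic :: "real^2 \<Rightarrow> real^2 \<Rightarrow> real^3^3 \<Rightarrow> complex poly" where
  "multiplier_sextic u1 u2 F =
     (case centered F (complexify u1, complexify u2) of (a1, a2, b1, b2) \<Rightarrow>
        bilinear_problem.Q (F $ 1 $ 1) (F $ 1 $ 2) (F $ 2 $ 1) (F $ 2 $ 2) a1 a2 b1 b2)"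

text \<open>The factors express in turn that \<open>A\<close> is invertible, that \<open>G\<close>
  has full degree 10, and that \<open>G\<close> has no multiple root. The sizes 10 and 9 are
  constants so that the resultant is polynomial in the data.\<close>

definition genericity :: "real^2 \<Rightarrow> real^2 \<Rightarrow> real^3^3 \<Rightarrow> complex" where
  "genericity u1 u2 F =
     (let G = multiplier_sextic u1 u2 F * pencil_det F
      in minor2 F * coeff G 10 * resultant_sub 10 9 G (pderiv G))"

text \<open>The count for the bilinear problem is pulled back along the bijection
  \<open>centered F\<close>.\<close>

lemma card_complex_critical_points:
  assumes "fundamental_matrix F" and "genericity u1 u2 F \<noteq> 0"
  shows "card (complex_critical_points u1 u2 F) = 6"
proof -
  have minor: "minor2 F \<noteq> 0" using assms(2) by (auto simp: genericity_def)
  have det: "Determinants.det F = 0"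
    using assms(1) by (simp add: det_eq_0_rank fundamental_matrix_def)
  obtain a1 a2 b1 b2 where a: "centered F (complexify u1, complexify u2) = (a1, a2, b1, b2)"
    by (metis prod_cases4)
  interpret bilinear_problem "F $ 1 $ 1" "F $ 1 $ 2" "F $ 2 $ 1" "F $ 2 $ 2" a1 a2 b1 b2 .
  have G: "multiplier_sextic u1 u2 F * pencil_det F = Q * D"
    by (simp add: multiplier_sextic_def pencil_det_def a)
  let ?C = "{(y1, y2, z1, z2). bilinear y1 y2 z1 z2 = 0 \<and> (\<exists>\<nu>. stationary \<nu> y1 y2 z1 z2)}"
  have "card ?C = 6"
  proof (rule card_critical)
    have "complex_of_real (minor2 F) \<noteq> 0" using minor by simp
    then show "complex_of_real (F $ 1 $ 1) * complex_of_real (F $ 2 $ 2)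
        - complex_of_real (F $ 1 $ 2) * complex_of_real (F $ 2 $ 1) \<noteq> 0"
      by (simp add: minor2_def)
  qed (use assms(2) in \<open>auto simp: genericity_def G\<close>)
  moreover have "complex_critical_points u1 u2 F = centered F -` ?C"
  proof (rule Set.set_eqI)
    fix x
    obtain y1 y2 z1 z2 where "centered F x = (y1, y2, z1, z2)" by (metis prod_cases4)
    then show "x \<in> complex_critical_points u1 u2 F \<longleftrightarrow> x \<in> centered F -` ?C"
      using critical_point_iff[OF minor det a] by simp
  qed
  ultimately show ?thesis
    using card_vimage_inj[of "centered F" ?C] bij_centered[OF minor]
    by (simp add: bij_def)
qed

lemma complex_polynomial_function_genericity:
  "complex_polynomial_function (\<lambda>(u1, u2, F). genericity u1 u2 F)"
proof -
  have u1: "complex_polynomial_function (\<lambda>d :: (real^2) \<times> (real^2) \<times> (real^3^3).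
      of_real (fst d $ i))" for i
    by (intro complex_polynomial_function_of_real real_polynomial_function.intros(1)
        linear_conv_bounded_linear[THEN iffD1] linearI) auto
  have u2: "complex_polynomial_function (\<lambda>d :: (real^2) \<times> (real^2) \<times> (real^3^3).
      of_real (fst (snd d) $ i))" for i
    by (intro complex_polynomial_function_of_real real_polynomial_function.intros(1)
        linear_conv_bounded_linear[THEN iffD1] linearI) auto
  have F: "complex_polynomial_function (\<lambda>d :: (real^2) \<times> (real^2) \<times> (real^3^3).
      of_real (snd (snd d) $ i $ j))" for i j
    by (intro complex_polynomial_function_of_real real_polynomial_function.intros(1)
        linear_conv_bounded_linear[THEN iffD1] linearI) auto
  note rules = u1 u2 F complex_polynomial_function_add complex_polynomial_function_diff
    complex_polynomial_function_mult
  have minor: "complex_polynomial_function (\<lambda>d :: (real^2) \<times> (real^2) \<times> (real^3^3).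
      of_real (minor2 (snd (snd d))))"
    unfolding minor2_def of_real_diff of_real_mult by (intro rules)
  have "polynomial_coefficients (\<lambda>d :: (real^2) \<times> (real^2) \<times> (real^3^3).
      multiplier_sextic (fst d) (fst (snd d)) (snd (snd d)))"
    unfolding multiplier_sextic_def centered_def complexify_def prod.case vec_lambda_beta
      of_real_diff of_real_mult
    by (intro polynomial_coefficients_Q rules minor)
  moreover have "polynomial_coefficients (\<lambda>d :: (real^2) \<times> (real^2) \<times> (real^3^3).
      pencil_det (snd (snd d)))"
    unfolding pencil_det_def by (intro polynomial_coefficients_D rules)
  ultimately have "polynomial_coefficients (\<lambda>d :: (real^2) \<times> (real^2) \<times> (real^3^3).
      multiplier_sextic (fst d) (fst (snd d)) (snd (snd d)) * pencil_det (snd (snd d)))"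
    (is "polynomial_coefficients ?G") by (rule polynomial_coefficients_mult)
  then have "complex_polynomial_function (\<lambda>d :: (real^2) \<times> (real^2) \<times> (real^3^3).
      minor2 (snd (snd d)) * coeff (?G d) 10 * resultant_sub 10 9 (?G d) (pderiv (?G d)))"
    by (intro complex_polynomial_function_mult minor complex_polynomial_function_resultant_sub
        polynomial_coefficients_pderiv) (simp_all add: polynomial_coefficients_def)
  then show ?thesis
    by (simp add: genericity_def Let_def case_prod_unfold)
qed

text \<open>The block \<open>A\<close> is a shear of determinant 1 and the last row and column are
  zero, so \<open>centered F\<close> merely lists the coordinates and \<open>G\<close> has small
  integer coefficients.\<close>

lemma genericity_witness:
  fixes F :: "real^3^3"
  defines "F \<equiv> vector [vector [1, 1, 0], vector [0, 1, 0], vector [0, 0, 0]]"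
  shows "fundamental_matrix F"
    and "genericity (vector [-1, 0]) (vector [2, 0]) F \<noteq> 0"
proof -
  have entries [simp]: "F $ 1 $ 1 = 1" "F $ 1 $ 2 = 1" "F $ 1 $ 3 = 0"
    "F $ 2 $ 1 = 0" "F $ 2 $ 2 = 1" "F $ 2 $ 3 = 0"
    "F $ 3 $ 1 = 0" "F $ 3 $ 2 = 0" "F $ 3 $ 3 = 0"
    by (simp_all add: F_def)
  \<comment> \<open>Two basis vectors in the range give rank at least 2; the zero determinant gives
    the other bound.\<close>
  have "F *v axis 1 1 = axis 1 1" "F *v (axis 2 1 - axis 1 1) = axis 2 1"
    by (simp_all add: Finite_Cartesian_Product.vec_eq_iff forall_3 matrix_vector_mult_def sum_3
        axis_def)
  then have "{axis 1 1, axis 2 1} \<subseteq> range ((*v) F)"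
    by (metis empty_subsetI insert_subset rangeI)
  moreover have "independent {axis 1 1, axis 2 1 :: real^3}"
    by (rule independent_mono[OF independent_Basis]) (auto simp: axis_in_Basis_iff)
  ultimately have "card {axis 1 1, axis 2 1 :: real^3} \<le> rank F"
    unfolding rank_dim_range by (rule independent_card_le_dim)
  then have "2 \<le> rank F" by (simp add: axis_eq_axis)
  moreover have "Determinants.det F = 0" by (simp add: det_3)
  then have "rank F < 3" by (simp add: det_eq_0_rank)
  ultimately show "fundamental_matrix F" by (simp add: fundamental_matrix_def)

  \<comment> \<open>The Bezout cofactors below come from the extended Euclidean algorithm for \<open>G\<close> and \<open>G'\<close>.\<close>
  define G :: "complex poly" where
    "G = [:- 2, - 9, 6, 37, - 2, - 45, - 2, 28, 6, - 6, - 2:]"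
  have G: "multiplier_sextic (vector [-1, 0]) (vector [2, 0]) F * pencil_det F = G"
    by (simp add: multiplier_sextic_def pencil_det_def centered_def complexify_def
        minor2_def bilinear_problem.Q_def bilinear_problem.Y1_def bilinear_problem.Y2_def
        bilinear_problem.Z1_def bilinear_problem.Z2_def bilinear_problem.D_def G_def)
  have deg: "degree G = 10" "degree (pderiv G) = 9"
    by (simp_all add: G_def degree_pderiv)
  have bezout: "[:3192, - 17862, - 7572, 42055, 2740, - 33454, - 6756, 8714, 3020:] * G
    + [:- 1126, - 724, 6820, 606, - 8139, - 228, 4678, 840, - 962, - 302:] * pderiv G = [:3750:]"
    by (simp add: G_def pderiv_pCons)
  have G0: "G \<noteq> 0" by (simp add: G_def)
  have "coprime G (pderiv G)"
  proof (rule coprimeI)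
    fix c assume "c dvd G" "c dvd pderiv G"
    then have "c dvd [:3750:]" unfolding bezout[symmetric] by (intro dvd_add dvd_mult)
    moreover have "is_unit [:3750 :: complex:]" by (simp add: is_unit_iff_degree)
    ultimately show "is_unit c" by (rule dvd_trans)
  qed
  then have "resultant_sub 10 9 G (pderiv G) \<noteq> 0"
    using resultant_nonzero_iff_coprime[OF G0, of "pderiv G"] deg by (simp add: resultant_sub)
  moreover have "coeff G 10 \<noteq> 0" using leading_coeff_neq_0[OF G0] deg(1) by simp
  ultimately show "genericity (vector [-1, 0]) (vector [2, 0]) F \<noteq> 0"
    by (simp add: genericity_def G minor2_def)
qed

theorem theorem2p1:
  shows "\<exists>P :: (real^2) \<times> (real^2) \<times> (real^3^3) \<Rightarrow> real.
    real_polynomial_function P \<and>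
    (\<exists>u1 u2 F. fundamental_matrix F \<and> P (u1, u2, F) \<noteq> 0) \<and>
    (\<forall>u1 u2 F. fundamental_matrix F \<and> P (u1, u2, F) \<noteq> 0 \<longrightarrow>
       card (complex_critical_points u1 u2 F) = 6)"
proof -
  let ?R = "\<lambda>(u1, u2, F). genericity u1 u2 F"
  \<comment> \<open>The squared modulus is a real polynomial with the same zeros as the complex
    one.\<close>
  let ?P = "\<lambda>d. (Re (?R d))\<^sup>2 + (Im (?R d))\<^sup>2"
  have "real_polynomial_function ?P"
    using complex_polynomial_function_genericity
    by (auto simp: complex_polynomial_function_def)
  moreover have "?P (u1, u2, F) \<noteq> 0 \<longleftrightarrow> genericity u1 u2 F \<noteq> 0" for u1 u2 F
    by (simp add: complex_eq_iff del: sum_power2_gt_zero_iff)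
  ultimately show ?thesis
    using genericity_witness card_complex_critical_points by (intro exI[of _ ?P] conjI) blast+
qed

end
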